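(* Let $T_1:\mathcal{M}\to\mathcal{M}$ and $T_2:\mathcal{N}\to\mathcal{N}$ be two dynamical systems that are topologically conjugate with homeomorphism $h:\mathcal{N}\to\mathcal{M}$, i.e. $T_1=h\circ T_2\circ h^{-1}$, and let $\mathbb{U}_1$ and $\mathbb{U}_2$ be the Koopman operators of $T_1$ and $T_2$. Then the eigenvalues and eigenfunctions of $\mathbb{U}_1$ and $\mathbb{U}_2$ are in one-to-one correspondence via $h$: $\mathbb{U}_1$ and $\mathbb{U}_2$ have the same eigenvalues, and for each eigenvalue $\lambda$ the map $\phi\mapsto\phi\circ h$ is a bijection from the eigenfunctions of $\mathbb{U}_1$ with eigenvalue $\lambda$ onto the eigenfunctions of $\mathbb{U}_2$ with eigenvalue $\lambda$, with inverse $\bar\phi\mapsto\bar\phi\circ h^{-1}$.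
   Context: $\mathcal{M}$ and $\mathcal{N}$ are the state spaces (topological spaces) of the two discrete-time systems $x_{t+1}=T_1(x_t)$ and $y_{t+1}=T_2(y_t)$. Let $\mathcal{F}_{\mathcal{M}}$ and $\mathcal{F}_{\mathcal{N}}$ be the (complex vector) spaces of observables, i.e. functions $\mathcal{M}\to\mathbb{C}$ and $\mathcal{N}\to\mathbb{C}$ respectively, on which the Koopman operators act; these are invariant under $\psi\mapsto\psi\circ T_1$ and $\psi\mapsto\psi\circ T_2$ respectively, and the observables on $\mathcal{N}$ are those obtained from observables on $\mathcal{M}$ through $h$: $\mathcal{F}_{\mathcal{N}}=\{\psi\circ h:\psi\in\mathcal{F}_{\mathcal{M}}\}$. The Koopman operators are $\mathbb{U}_1:\mathcal{F}_{\mathcal{M}}\to\mathcal{F}_{\mathcal{M}}$, $[\mathbb{U}_1\psi](x)=\psi(T_1(x))$, and $\mathbb{U}_2:\mathcal{F}_{\mathcal{N}}\to\mathcal{F}_{\mathcal{N}}$, $[\mathbb{U}_2\psi](y)=\psi(T_2(y))$. An eigenfunction of $\mathbb{U}_k$ with eigenvalue $\lambda\in\mathbb{C}$ is a nonzero element $\phi$ of the corresponding space with $\mathbb{U}_k\phi=\lambda\phi$. *)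

theory Defs
  imports "HOL-Analysis.Analysis"
begin

text \<open>
  A state space is an abstract topology; maps between state spaces matter only on the carriers
  (\<^const>\<open>topspace\<close>). A complex-valued function on \<open>X\<close> is represented by an element of
  \<open>topspace X \<rightarrow>\<^sub>E UNIV\<close>, i.e. it is \<^const>\<open>undefined\<close> off the carrier, so that HOL equality is
  equality of functions on \<open>X\<close>. Composition is \<^const>\<open>compose\<close>, with
  \<open>compose A f g = (\<lambda>x\<in>A. f (g x))\<close>.
\<close>

definition zero_fun :: "'a topology \<Rightarrow> 'a \<Rightarrow> complex" where
  "zero_fun X = (\<lambda>x\<in>topspace X. 0)"

definition add_fun :: "'a topology \<Rightarrow> ('a \<Rightarrow> complex) \<Rightarrow> ('a \<Rightarrow> complex) \<Rightarrow> 'a \<Rightarrow> complex" where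
  "add_fun X \<phi> \<psi> = (\<lambda>x\<in>topspace X. \<phi> x + \<psi> x)"

definition scale_fun :: "'a topology \<Rightarrow> complex \<Rightarrow> ('a \<Rightarrow> complex) \<Rightarrow> 'a \<Rightarrow> complex" where
  "scale_fun X c \<phi> = (\<lambda>x\<in>topspace X. c * \<phi> x)"

definition function_space :: "'a topology \<Rightarrow> ('a \<Rightarrow> complex) set \<Rightarrow> bool" where
  "function_space X F \<longleftrightarrow>
     F \<subseteq> (topspace X \<rightarrow>\<^sub>E UNIV) \<and> zero_fun X \<in> F \<and>
     (\<forall>\<phi>\<in>F. \<forall>\<psi>\<in>F. add_fun X \<phi> \<psi> \<in> F) \<and> (\<forall>c. \<forall>\<phi>\<in>F. scale_fun X c \<phi> \<in> F)"

definition observable_space ::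
  "'a topology \<Rightarrow> ('a \<Rightarrow> 'a) \<Rightarrow> ('a \<Rightarrow> complex) set \<Rightarrow> bool" where
  "observable_space X T F \<longleftrightarrow>
     function_space X F \<and> (\<forall>\<psi>\<in>F. compose (topspace X) \<psi> T \<in> F)"

definition koopman ::
  "'a topology \<Rightarrow> ('a \<Rightarrow> complex) set \<Rightarrow> ('a \<Rightarrow> 'a) \<Rightarrow> ('a \<Rightarrow> complex) \<Rightarrow> 'a \<Rightarrow> complex" where
  "koopman X F T = (\<lambda>\<psi>\<in>F. \<lambda>x\<in>topspace X. \<psi> (T x))"

definition eigenfunctions ::
  "'a topology \<Rightarrow> ('a \<Rightarrow> complex) set \<Rightarrow> (('a \<Rightarrow> complex) \<Rightarrow> 'a \<Rightarrow> complex) \<Rightarrow> complex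
    \<Rightarrow> ('a \<Rightarrow> complex) set" where
  "eigenfunctions X F U \<mu> = {\<phi>\<in>F. \<phi> \<noteq> zero_fun X \<and> U \<phi> = scale_fun X \<mu> \<phi>}"

definition eigenvalues ::
  "'a topology \<Rightarrow> ('a \<Rightarrow> complex) set \<Rightarrow> (('a \<Rightarrow> complex) \<Rightarrow> 'a \<Rightarrow> complex) \<Rightarrow> complex set" where
  "eigenvalues X F U = {\<mu>. \<exists>\<phi>. \<phi> \<in> eigenfunctions X F U \<mu>}"

text \<open>\<open>h'\<close> is the inverse of the homeomorphism \<open>h\<close>; it is determined by \<open>h\<close> on \<open>topspace M\<close>.\<close>

definition topologically_conjugate ::
  "'m topology \<Rightarrow> 'n topology \<Rightarrow> ('m \<Rightarrow> 'm) \<Rightarrow> ('n \<Rightarrow> 'n) \<Rightarrow> ('n \<Rightarrow> 'm) \<Rightarrow> ('m \<Rightarrow> 'n) \<Rightarrow> bool" where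
  "topologically_conjugate M N T1 T2 h h' \<longleftrightarrow>
     homeomorphic_maps N M h h' \<and> (\<forall>x\<in>topspace M. T1 x = (h \<circ> T2 \<circ> h') x)"

end

theory Submission
  imports Defs
begin

text \<open>
  The conjugacy \<open>T1 = h \<circ> T2 \<circ> h'\<close> says that \<open>h\<close> intertwines the dynamics, \<open>h \<circ> T2 = T1 \<circ> h\<close>, so
  composition with \<open>h\<close> intertwines the Koopman operators: \<open>U2 (\<phi> \<circ> h) = (U1 \<phi>) \<circ> h\<close>. Since \<open>h\<close> is
  onto, a function on \<open>M\<close> is determined by its pullback along \<open>h\<close>; hence the pullback solves the
  eigenvalue equation, or vanishes, exactly when the function itself does
  (\<open>pullback_eigenfunction_iff\<close>). The observables on \<open>N\<close> are by hypothesis the pullbacks of those on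
  \<open>M\<close>, so the eigenfunctions of \<open>U2\<close> are precisely the pullbacks of eigenfunctions of \<open>U1\<close>.
  Composition with \<open>h'\<close> undoes the pullback, and equality of the spectra follows because one
  system has eigenfunctions for a given \<open>\<mu>\<close> if and only if the other does.
\<close>

text \<open>
  Observables agree off the carrier, where all are undefined, so the eigenvalue equation and the
  condition \<open>\<phi> \<noteq> 0\<close> can be read pointwise on the carrier.
\<close>

lemma eigenfunctions_koopman_iff:
  assumes "F \<subseteq> topspace X \<rightarrow>\<^sub>E UNIV"
  shows "\<phi> \<in> eigenfunctions X F (koopman X F T) \<mu> \<longleftrightarrow>
    \<phi> \<in> F \<and> (\<exists>x\<in>topspace X. \<phi> x \<noteq> 0) \<and> (\<forall>x\<in>topspace X. \<phi> (T x) = \<mu> * \<phi> x)"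
proof (cases "\<phi> \<in> F")
  case True
  then have ext: "\<phi> \<in> extensional (topspace X)"
    using assms by (auto simp: PiE_def)
  have "\<phi> = zero_fun X \<longleftrightarrow> (\<forall>x\<in>topspace X. \<phi> x = 0)"
    using ext by (auto simp: zero_fun_def fun_eq_iff restrict_def extensional_def)
  moreover have "koopman X F T \<phi> = scale_fun X \<mu> \<phi> \<longleftrightarrow>
      (\<forall>x\<in>topspace X. \<phi> (T x) = \<mu> * \<phi> x)"
    using True by (auto simp: koopman_def scale_fun_def fun_eq_iff restrict_def)
  ultimately show ?thesis
    using True by (auto simp: eigenfunctions_def)
qed (simp add: eigenfunctions_def)

text \<open>
  Here \<open>h\<close> is a semiconjugacy. At \<open>y\<close> the eigenvalue equation for the pullback is the equation for
  \<open>\<phi>\<close> at \<open>h y\<close>, and as \<open>h\<close> is onto, every point of \<open>X\<close> is reached in this way; for the same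
  reason the pullback of a nonzero function is nonzero.
\<close>

lemma pullback_eigenfunction_iff:
  assumes F: "F \<subseteq> topspace X \<rightarrow>\<^sub>E UNIV" and G: "G \<subseteq> topspace Y \<rightarrow>\<^sub>E UNIV"
    and onto: "h ` topspace Y = topspace X"
    and S: "S \<in> topspace Y \<rightarrow> topspace Y"
    and intertwine: "\<And>y. y \<in> topspace Y \<Longrightarrow> h (S y) = T (h y)"
    and \<phi>: "\<phi> \<in> F" "compose (topspace Y) \<phi> h \<in> G"
  shows "compose (topspace Y) \<phi> h \<in> eigenfunctions Y G (koopman Y G S) \<mu> \<longleftrightarrow>
    \<phi> \<in> eigenfunctions X F (koopman X F T) \<mu>"
proof -
  have "(\<exists>y\<in>topspace Y. compose (topspace Y) \<phi> h y \<noteq> 0) \<longleftrightarrow> (\<exists>x\<in>topspace X. \<phi> x \<noteq> 0)"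
    unfolding onto[symmetric] by (simp add: compose_def)
  moreover have "(\<forall>y\<in>topspace Y. compose (topspace Y) \<phi> h (S y) = \<mu> * compose (topspace Y) \<phi> h y)
      \<longleftrightarrow> (\<forall>x\<in>topspace X. \<phi> (T x) = \<mu> * \<phi> x)"
    unfolding onto[symmetric] using S intertwine by (simp add: compose_def Pi_iff)
  ultimately show ?thesis
    using \<phi> by (simp add: eigenfunctions_koopman_iff[OF F] eigenfunctions_koopman_iff[OF G])
qed

lemma compose_compose_inverse:
  assumes "\<phi> \<in> extensional A" and "g \<in> A \<rightarrow> B" and "\<And>x. x \<in> A \<Longrightarrow> f (g x) = x"
  shows "compose A (compose B \<phi> f) g = \<phi>"
  by (rule extensionalityI[of _ A]) (use assms in \<open>auto simp: compose_def\<close>)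

theorem proposition14:
  fixes M :: "'m topology" and N :: "'n topology"
    and T1 :: "'m \<Rightarrow> 'm" and T2 :: "'n \<Rightarrow> 'n"
    and h :: "'n \<Rightarrow> 'm" and h' :: "'m \<Rightarrow> 'n"
    and FM :: "('m \<Rightarrow> complex) set" and FN :: "('n \<Rightarrow> complex) set"
    and U1 :: "('m \<Rightarrow> complex) \<Rightarrow> 'm \<Rightarrow> complex"
    and U2 :: "('n \<Rightarrow> complex) \<Rightarrow> 'n \<Rightarrow> complex"
  assumes "T1 \<in> topspace M \<rightarrow> topspace M"
    and "T2 \<in> topspace N \<rightarrow> topspace N"
    and "topologically_conjugate M N T1 T2 h h'"
    and "observable_space M T1 FM"
    and "observable_space N T2 FN"
    and "FN = {compose (topspace N) \<psi> h | \<psi>. \<psi> \<in> FM}"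
    and "U1 = koopman M FM T1"
    and "U2 = koopman N FN T2"
  shows "eigenvalues M FM U1 = eigenvalues N FN U2 \<and>
    (\<forall>\<mu>\<in>eigenvalues M FM U1.
       bij_betw (\<lambda>\<phi>. compose (topspace N) \<phi> h)
         (eigenfunctions M FM U1 \<mu>) (eigenfunctions N FN U2 \<mu>) \<and>
       (\<forall>\<phi>\<in>eigenfunctions M FM U1 \<mu>.
          compose (topspace M) (compose (topspace N) \<phi> h) h' = \<phi>) \<and>
       (\<forall>\<phi>'\<in>eigenfunctions N FN U2 \<mu>.
          compose (topspace M) \<phi>' h' \<in> eigenfunctions M FM U1 \<mu> \<and>
          compose (topspace N) (compose (topspace M) \<phi>' h') h = \<phi>'))"
proof -
  have h: "h \<in> topspace N \<rightarrow> topspace M" and h': "h' \<in> topspace M \<rightarrow> topspace N"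
    and h'h: "\<And>y. y \<in> topspace N \<Longrightarrow> h' (h y) = y"
    and hh': "\<And>x. x \<in> topspace M \<Longrightarrow> h (h' x) = x"
    and T1: "\<And>x. x \<in> topspace M \<Longrightarrow> T1 x = h (T2 (h' x))"
    using assms(3) by (auto simp: topologically_conjugate_def homeomorphic_maps_def
        continuous_map_def)
  have onto: "h ` topspace N = topspace M"
    using h h' hh' by (force simp: image_iff)
  have intertwine: "h (T2 y) = T1 (h y)" if "y \<in> topspace N" for y
    using that h by (simp add: T1 h'h Pi_iff)
  have FM: "FM \<subseteq> topspace M \<rightarrow>\<^sub>E UNIV" and FN: "FN \<subseteq> topspace N \<rightarrow>\<^sub>E UNIV"
    using assms(4,5) by (auto simp: observable_space_def function_space_def)
  let ?pull = "\<lambda>\<phi>. compose (topspace N) \<phi> h"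
  let ?push = "\<lambda>\<phi>. compose (topspace M) \<phi> h'"
  let ?E1 = "eigenfunctions M FM U1"
  let ?E2 = "eigenfunctions N FN U2"
  have pull_iff: "?pull \<phi> \<in> ?E2 \<mu> \<longleftrightarrow> \<phi> \<in> ?E1 \<mu>" if "\<phi> \<in> FM" for \<phi> \<mu>
    unfolding assms(7,8)
    by (rule pullback_eigenfunction_iff[OF FM FN onto assms(2) intertwine that])
      (use that assms(6) in auto)
  have E1_FM: "?E1 \<mu> \<subseteq> FM" and E2_FN: "?E2 \<mu> \<subseteq> FN" for \<mu>
    by (auto simp: eigenfunctions_def)
  have image: "?pull ` ?E1 \<mu> = ?E2 \<mu>" for \<mu>
  proof
    show "?pull ` ?E1 \<mu> \<subseteq> ?E2 \<mu>"
      using pull_iff E1_FM by blast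
    show "?E2 \<mu> \<subseteq> ?pull ` ?E1 \<mu>"
    proof
      fix \<phi>' assume \<phi>': "\<phi>' \<in> ?E2 \<mu>"
      then obtain \<psi> where "\<psi> \<in> FM" "\<phi>' = ?pull \<psi>"
        using E2_FN assms(6) by blast
      then show "\<phi>' \<in> ?pull ` ?E1 \<mu>"
        using \<phi>' pull_iff by blast
    qed
  qed
  have push_pull: "?push (?pull \<phi>) = \<phi>" if "\<phi> \<in> ?E1 \<mu>" for \<phi> \<mu>
    by (rule compose_compose_inverse[OF _ h' hh'])
      (use that E1_FM FM in \<open>auto simp: PiE_def\<close>)
  have pull_push: "?pull (?push \<phi>') = \<phi>'" if "\<phi>' \<in> ?E2 \<mu>" for \<phi>' \<mu>
    by (rule compose_compose_inverse[OF _ h h'h])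
      (use that E2_FN FN in \<open>auto simp: PiE_def\<close>)
  have push_in: "?push \<phi>' \<in> ?E1 \<mu>" if "\<phi>' \<in> ?E2 \<mu>" for \<phi>' \<mu>
    using that push_pull unfolding image[symmetric] by auto
  have "bij_betw ?pull (?E1 \<mu>) (?E2 \<mu>)" for \<mu>
    unfolding bij_betw_def using image inj_on_inverseI[of "?E1 \<mu>" ?push ?pull] push_pull by blast
  moreover have "eigenvalues M FM U1 = eigenvalues N FN U2"
    unfolding eigenvalues_def using image by blast
  ultimately show ?thesis
    using push_pull pull_push push_in by blast
qed

end
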